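(* Let $\mathbb{O}$ be an octonion algebra over a field $F$. (a) Every subalgebra of dimension less than $4$ is associative. (b) If $\mathbb{O}$ is split then there do exist subalgebras of dimension $4$ that are not associative, namely, the totally singular ones (of the form $n\mathbb{O}$ or $\mathbb{O}n$ with $n\in\mathbb{O}$, $n^2=0\ne n$). Every other subalgebra of dimension $4$ is associative. (c) Every subalgebra of dimension greater than $4$ contains a non-associative subalgebra of dimension $4$. (d) If $\mathbb{O}$ is split then a given subalgebra is not associative if, and only if, it contains a maximal totally singular subspace of $\mathbb{O}$. (e) If $\mathbb{O}$ is not split then every proper subalgebra is associative.
   Context: $F$ is an arbitrary field (any characteristic). A composition algebra over $F$ is a (not necessarily associative) $F$-algebra $C$ with neutral element $1$ and a quadratic form $N\colon C\to F$ (norm) with $N(xy)=N(x)N(y)$ whose polar form $(x|y)=N(x+y)-N(x)-N(y)$ is non-degenerate. An octonion algebra is a composition algebra of dimension $8$; it is split if some non-zero element has norm $0$. A subalgebra is an $F$-linear subspace closed under multiplication (it need not contain $1$). A subspace $V$ is totally singular if $N(V)=\{0\}$. For $a\in\mathbb{O}$: $a\mathbb{O}=\{ax\mid x\in\mathbb{O}\}$, $\mathbb{O}a=\{xa\mid x\in\mathbb{O}\}$.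
   Formalization: In (c), the case of the whole algebra O when O is not split is excluded: there the claim fails, since by (e) every 4-dimensional subalgebra of a non-split O (e.g. the real octonions) is associative. *)

theory Defs
  imports Complex_Main
begin

text \<open>The vector space underlying an algebra is the whole type \<open>'a\<close>; subalgebras are subsets of it.\<close>

locale nonassoc_algebra = vector_space scale
  for scale :: "'f::field \<Rightarrow> 'a::ab_group_add \<Rightarrow> 'a" +
  fixes mult :: "'a \<Rightarrow> 'a \<Rightarrow> 'a"
  assumes linear_mult_left: "\<And>x. Vector_Spaces.linear scale scale (\<lambda>y. mult x y)"
    and linear_mult_right: "\<And>y. Vector_Spaces.linear scale scale (\<lambda>x. mult x y)"
begin

text \<open>A subalgebra need not contain a neutral element.\<close>

definition subalgebra :: "'a set \<Rightarrow> bool" where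
  "subalgebra S \<longleftrightarrow> subspace S \<and> (\<forall>x\<in>S. \<forall>y\<in>S. mult x y \<in> S)"

end

definition associative_on :: "('a \<Rightarrow> 'a \<Rightarrow> 'a) \<Rightarrow> 'a set \<Rightarrow> bool" where
  "associative_on mult S \<longleftrightarrow>
     (\<forall>x\<in>S. \<forall>y\<in>S. \<forall>z\<in>S. mult (mult x y) z = mult x (mult y z))"

definition polar :: "('a::ab_group_add \<Rightarrow> 'f::ab_group_add) \<Rightarrow> 'a \<Rightarrow> 'a \<Rightarrow> 'f" where
  "polar N x y = N (x + y) - N x - N y"

text \<open>Linearity into the ground field refers to the field as a vector space over itself,
  whose scalar multiplication is \<open>(*)\<close>.\<close>

locale quadratic_space = vector_space scale
  for scale :: "'f::field \<Rightarrow> 'a::ab_group_add \<Rightarrow> 'a" +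
  fixes N :: "'a \<Rightarrow> 'f"
  assumes norm_scale: "\<And>c x. N (scale c x) = c\<^sup>2 * N x"
    and linear_polar_left: "\<And>x. Vector_Spaces.linear scale (*) (\<lambda>y. polar N x y)"
    and linear_polar_right: "\<And>y. Vector_Spaces.linear scale (*) (\<lambda>x. polar N x y)"
begin

definition totally_singular :: "'a set \<Rightarrow> bool" where
  "totally_singular V \<longleftrightarrow> subspace V \<and> N ` V = {0}"

definition maximal_totally_singular :: "'a set \<Rightarrow> bool" where
  "maximal_totally_singular V \<longleftrightarrow>
     totally_singular V \<and> (\<forall>W. totally_singular W \<and> V \<subseteq> W \<longrightarrow> W = V)"

end

locale composition_algebra =
  nonassoc_algebra scale mult + quadratic_space scale N
  for scale :: "'f::field \<Rightarrow> 'a::ab_group_add \<Rightarrow> 'a"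
    and mult :: "'a \<Rightarrow> 'a \<Rightarrow> 'a"
    and N :: "'a \<Rightarrow> 'f" +
  fixes one :: 'a
  assumes one_mult: "\<And>x. mult one x = x"
    and mult_one: "\<And>x. mult x one = x"
    and norm_mult: "\<And>x y. N (mult x y) = N x * N y"
    and polar_nondegenerate: "\<And>x. (\<forall>y. polar N x y = 0) \<Longrightarrow> x = 0"

locale octonion_algebra = composition_algebra +
  assumes dim_eq_8: "dim UNIV = 8"

definition norm_split :: "('a::zero \<Rightarrow> 'f::zero) \<Rightarrow> bool" where
  "norm_split N \<longleftrightarrow> (\<exists>x. x \<noteq> 0 \<and> N x = 0)"

end

theory Submission
  imports Defs
begin

text \<open>A subalgebra \<open>S\<close> either contains \<open>1\<close> or is totally singular, because
  \<open>x\<^sup>2 = (x|1)x - N(x)1\<close>. The associator is alternating, so adjoining \<open>1\<close> reduces (a) to unital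
  subalgebras of dimension at most 4. If a unital one had a basis \<open>1, a, b, c\<close> with
  \<open>w = (a, b, c) \<noteq> 0\<close>, then \<open>(a, b, ab) = 0\<close> would force \<open>ab\<close> into the span of \<open>1, a, b\<close>;
  translating by scalars one gets \<open>ab = 0\<close>, hence \<open>N w = 0\<close> and \<open>w\<close> in the span of \<open>1, a, c\<close>,
  and cyclically \<open>w\<close> is a scalar of norm \<open>0\<close>.

  On \<open>n\<O> = {u. nu = 0}\<close> the product is \<open>(nx)u = (u|1)nx - (x|u)n\<close>, which is visibly not
  associative. In a totally singular subalgebra of dimension 4 the elements of trace \<open>0\<close> have a
  basis \<open>a, b, n = ab\<close> with \<open>n\<close> annihilating all three; for an idempotent \<open>e\<close> of trace \<open>1\<close>,
  either \<open>en = 0\<close> and \<open>S = \<O>n\<close>, or \<open>en \<noteq> 0\<close> and \<open>S = (en)\<O>\<close>.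

  If \<open>S\<close> is proper of dimension above 4, then \<open>P = S\<^sup>\<bottom>\<close> is an \<open>S\<close>-bimodule which is too small to
  contain elements of non-zero norm. For \<open>dim S \<ge> 6\<close> the kernel of \<open>s \<mapsto> sn\<close> on \<open>S\<close>, with
  \<open>0 \<noteq> n \<in> P\<close>, is all of \<open>\<O>n\<close>; for \<open>dim S = 5\<close> a totally singular extension of \<open>P\<close> by one
  vector lies in \<open>P\<^sup>\<bottom> = S\<close> and is a subalgebra.\<close>

section \<open>Bilinearity and orthogonality\<close>

text \<open>A linear right inverse of \<open>f\<close> on the image of \<open>S\<close> embeds that
  image in \<open>S\<close> as a complement of the kernel.\<close>

lemma (in finite_dimensional_vector_space) rank_nullity:
  assumes "Vector_Spaces.linear scale scale f" and S: "subspace S"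
  shows "dim (f ` S) + dim {x \<in> S. f x = 0} = dim S"
proof -
  interpret p: finite_dimensional_vector_space_pair scale Basis scale Basis
    by unfold_locales
  interpret f: Vector_Spaces.linear scale scale f by fact
  obtain g where g: "range g \<subseteq> S" "Vector_Spaces.linear scale scale g"
      "\<And>y. y \<in> f ` S \<Longrightarrow> f (g y) = y"
    using p.linear_exists_right_inverse_on[OF assms] by auto
  interpret g: Vector_Spaces.linear scale scale g by fact
  let ?I = "g ` f ` S" and ?K = "{x \<in> S. f x = 0}"
  have fS: "subspace (f ` S)" using S by (rule f.subspace_image)
  have K: "subspace ?K"
    using S by (auto simp: subspace_def f.add f.scale)
  have "inj_on g (f ` S)" by (metis g(3) inj_onI)
  then have "dim ?I = dim (f ` S)"
    using p.dim_image_eq[OF g(2), of "f ` S"] fS by (metis span_eq_iff)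
  moreover have "{x + y |x y. x \<in> ?I \<and> y \<in> ?K} = S"
  proof (intro equalityI subsetI)
    fix z assume "z \<in> S"
    then have "g (f z) \<in> ?I" "z - g (f z) \<in> ?K"
      using S g(1,3) by (auto simp: f.diff intro!: subspace_diff)
    then show "z \<in> {x + y |x y. x \<in> ?I \<and> y \<in> ?K}"
      by (smt (verit) add_diff_cancel_left' diff_add_cancel mem_Collect_eq add.commute)
  qed (use S g(1) in \<open>auto intro!: subspace_add\<close>)
  moreover have "?I \<inter> ?K = {0}"
    using g(3) S subspace_0[OF S] by (force simp: g.zero f.zero image_iff)
  ultimately show ?thesis
    using dim_sums_Int[OF g.subspace_image[OF fS] K] by simp
qed

lemma (in nonassoc_algebra) mult_linear [simp]:
  "mult (x + y) z = mult x z + mult y z" "mult x (y + z) = mult x y + mult x z"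
  "mult (x - y) z = mult x z - mult y z" "mult x (y - z) = mult x y - mult x z"
  "mult (- x) z = - mult x z" "mult x (- z) = - mult x z"
  "mult (scale c x) z = scale c (mult x z)" "mult x (scale c z) = scale c (mult x z)"
  "mult 0 z = 0" "mult x 0 = 0"
proof -
  interpret l: Vector_Spaces.linear scale scale "\<lambda>y. mult x y" for x
    by (rule linear_mult_left)
  interpret r: Vector_Spaces.linear scale scale "\<lambda>x. mult x y" for y
    by (rule linear_mult_right)
  show "mult (x + y) z = mult x z + mult y z" "mult x (y + z) = mult x y + mult x z"
    "mult (x - y) z = mult x z - mult y z" "mult x (y - z) = mult x y - mult x z"
    "mult (- x) z = - mult x z" "mult x (- z) = - mult x z"
    "mult (scale c x) z = scale c (mult x z)" "mult x (scale c z) = scale c (mult x z)"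
    "mult 0 z = 0" "mult x 0 = 0"
    by (fact l.add r.add l.diff r.diff l.neg r.neg l.scale r.scale l.zero r.zero)+
qed

lemma (in quadratic_space) polar_linear [simp]:
  "polar N (x + y) z = polar N x z + polar N y z"
  "polar N x (y + z) = polar N x y + polar N x z"
  "polar N (x - y) z = polar N x z - polar N y z"
  "polar N x (y - z) = polar N x y - polar N x z"
  "polar N (- x) z = - polar N x z" "polar N x (- z) = - polar N x z"
  "polar N (scale c x) z = c * polar N x z" "polar N x (scale c z) = c * polar N x z"
  "polar N 0 z = 0" "polar N x 0 = 0"
proof -
  interpret l: Vector_Spaces.linear scale "(*)" "\<lambda>y. polar N x y" for x
    by (rule linear_polar_left)
  interpret r: Vector_Spaces.linear scale "(*)" "\<lambda>x. polar N x y" for y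
    by (rule linear_polar_right)
  show "polar N (x + y) z = polar N x z + polar N y z"
    "polar N x (y + z) = polar N x y + polar N x z"
    "polar N (x - y) z = polar N x z - polar N y z"
    "polar N x (y - z) = polar N x y - polar N x z"
    "polar N (- x) z = - polar N x z" "polar N x (- z) = - polar N x z"
    "polar N (scale c x) z = c * polar N x z" "polar N x (scale c z) = c * polar N x z"
    "polar N 0 z = 0" "polar N x 0 = 0"
    by (fact l.add r.add l.diff r.diff l.neg r.neg l.scale r.scale l.zero r.zero)+
qed

context quadratic_space
begin

lemma norm_zero [simp]: "N 0 = 0"
  using norm_scale[of 0 0] by simp

lemma norm_add: "N (x + y) = N x + N y + polar N x y"
  by (simp add: polar_def)

lemma polar_commute: "polar N x y = polar N y x"
  by (simp add: polar_def add.commute)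

lemma polar_same: "polar N x x = 2 * N x"
proof -
  have "N (x + x) = N (scale 2 x)"
    by (metis one_add_one scale_left_distrib scale_one)
  then show ?thesis by (simp add: polar_def norm_scale)
qed

lemma norm_minus [simp]: "N (- x) = N x"
  using norm_scale[of "-1" x] by simp

lemma totally_singular_polar:
  assumes "totally_singular V" "x \<in> V" "y \<in> V"
  shows "polar N x y = 0"
  using assms unfolding totally_singular_def polar_def
  by (metis (no_types, lifting) diff_zero image_eqI singletonD subspace_add)

lemma totally_singularI:
  assumes "subspace V" "\<And>x. x \<in> V \<Longrightarrow> N x = 0"
  shows "totally_singular V"
  using assms subspace_0 by (auto simp: totally_singular_def image_iff)

lemma totally_singularD:
  "totally_singular V \<Longrightarrow> subspace V" "totally_singular V \<Longrightarrow> x \<in> V \<Longrightarrow> N x = 0"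
  by (auto simp: totally_singular_def)

lemma totally_singular_span_insert:
  assumes V: "totally_singular V" and w: "N w = 0" "\<And>v. v \<in> V \<Longrightarrow> polar N v w = 0"
  shows "totally_singular (span (insert w V))"
proof (rule totally_singularI)
  fix x assume "x \<in> span (insert w V)"
  then obtain k where "x - scale k w \<in> V"
    using V by (auto simp: span_breakdown_eq totally_singular_def dest: span_eq_iff[THEN iffD2])
  then have "N ((x - scale k w) + scale k w) = 0"
    unfolding norm_add
    using w(1) w(2)[of "x - scale k w"] totally_singularD(2)[OF V]
    by (simp add: norm_scale del: polar_linear(1,3))
  then show "N x = 0" by simp
qed simp

definition orth :: "'a set \<Rightarrow> 'a set" where
  "orth W = {y. \<forall>x\<in>W. polar N x y = 0}"

lemma subspace_orth [simp]: "subspace (orth W)"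
  by (auto simp: orth_def subspace_def)

lemma orth_antimono: "A \<subseteq> B \<Longrightarrow> orth B \<subseteq> orth A"
  by (auto simp: orth_def)

lemma totally_singular_subset_orth: "totally_singular V \<Longrightarrow> V \<subseteq> orth V"
  by (auto simp: orth_def totally_singular_polar)

end

section \<open>Composition and associator identities\<close>

context composition_algebra
begin

abbreviation trace :: "'a \<Rightarrow> 'f" where "trace x \<equiv> polar N x one"

definition conjugate :: "'a \<Rightarrow> 'a" where "conjugate x = scale (trace x) one - x"

definition associator :: "'a \<Rightarrow> 'a \<Rightarrow> 'a \<Rightarrow> 'a" where
  "associator x y z = mult (mult x y) z - mult x (mult y z)"

lemma polar_eqI: "(\<And>z. polar N x z = polar N y z) \<Longrightarrow> x = y"
  using polar_nondegenerate[of "x - y"] by simp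

lemma polar_mult_mult:
  "polar N (mult x y) (mult x z) = N x * polar N y z"
  "polar N (mult y x) (mult z x) = N x * polar N y z"
  by (simp_all add: polar_def norm_mult algebra_simps flip: mult_linear)

text \<open>This is N(xy) = N(x)N(y) linearized in both factors. Setting one argument to
  \<open>one\<close> gives the adjoints of left and right multiplication.\<close>

lemma polar_mult_exchange:
  "polar N (mult x y) (mult w z) + polar N (mult w y) (mult x z) = polar N x w * polar N y z"
  using polar_mult_mult(1)[of "x + w" y z]
  by (simp add: polar_mult_mult norm_add algebra_simps polar_commute[of w x])

lemma polar_mult_left: "polar N (mult x y) z = polar N y (mult (conjugate x) z)"
  using polar_mult_exchange[of x y one z]
  by (simp add: conjugate_def one_mult algebra_simps)

lemma polar_mult_right: "polar N (mult y x) z = polar N y (mult z (conjugate x))"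
  using polar_mult_exchange[of y x z one] polar_commute[of "mult z x"]
  by (simp add: conjugate_def mult_one algebra_simps)

lemma mult_closed:
  "subalgebra S \<Longrightarrow> x \<in> S \<Longrightarrow> y \<in> S \<Longrightarrow> mult x y \<in> S"
  by (simp add: subalgebra_def)

end

section \<open>Finite dimension and orthogonal complements\<close>

context octonion_algebra
begin

text \<open>The locale of finite-dimensional spaces takes a basis as a parameter, so one is fixed by
  choice.\<close>

definition some_basis :: "'b set" where
  "some_basis = (SOME B. independent B \<and> span B = UNIV)"

lemma some_basis: "independent some_basis" "span some_basis = UNIV"
proof -
  have "\<exists>B. independent B \<and> span B = UNIV"
    by (metis basis_exists top.extremum_uniqueI)
  then have "independent some_basis \<and> span some_basis = UNIV"
    unfolding some_basis_def by (rule someI_ex)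
  then show "independent some_basis" "span some_basis = UNIV" by auto
qed

sublocale finite_dimensional_vector_space scale some_basis
proof
  \<comment> \<open>An infinite basis would have \<open>card\<close> 0, hence give dimension 0
    instead of 8.\<close>
  show "finite some_basis"
    using dim_eq_8 some_basis by (metis card.infinite dim_eq_card span_UNIV zero_neq_numeral)
qed (use some_basis in auto)

text \<open>Reversing the product keeps norm, unit and linear structure, so results on n\<O>
  transfer to \<O>n.\<close>

lemma octonion_algebra_opposite:
  "octonion_algebra scale (\<lambda>x y. mult y x) N one"
proof unfold_locales
  show "N (mult y x) = N x * N y" for x y by (simp add: norm_mult mult.commute)
qed (use dim_eq_8 in \<open>auto simp: one_mult mult_one polar_nondegenerate\<close>)

text \<open>Extend a basis \<open>B\<close> of \<open>W\<close> to a basis \<open>C\<close> of the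
  whole space and let \<open>f\<close> send y to the vector with coordinates (c|y). Non-degeneracy
  makes \<open>f\<close> bijective, and y is orthogonal to \<open>W\<close> exactly if its image has
  zero coordinates at \<open>B\<close>; so \<open>f\<close> carries \<open>orth W\<close> onto the
  span of \<open>C - B\<close>.\<close>

lemma dim_orth:
  assumes "subspace W"
  shows "dim W + dim (orth W) = 8"
proof -
  interpret p: finite_dimensional_vector_space_pair scale some_basis scale some_basis
    by unfold_locales
  obtain B where B: "finite B" "B \<subseteq> W" "independent B" "span B = W" "card B = dim W"
    using basis_subspace_exists[OF assms] .
  obtain C where C: "B \<subseteq> C" "independent C" "span C = UNIV"
    using maximal_independent_subset_extend[of B UNIV] B by (metis subset_UNIV top.extremum_uniqueI)
  have fC: "finite C" by (rule finiteI_independent) fact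
  have cC: "card C = 8" using C dim_eq_8 by (metis dim_eq_card span_UNIV)
  define f where "f y = (\<Sum>c\<in>C. scale (polar N c y) c)" for y
  have lf: "Vector_Spaces.linear scale scale f"
    by unfold_locales (simp_all add: f_def scale_left_distrib sum.distrib scale_sum_right)
  interpret f: Vector_Spaces.linear scale scale f by fact
  have f0: "y = 0" if "f y = 0" for y
  proof (rule polar_nondegenerate)
    have "polar N c y = 0" if "c \<in> C" for c
      by (rule independentD[OF C(2) fC order_refl]) (use \<open>f y = 0\<close> that in \<open>auto simp: f_def\<close>)
    then have "C \<subseteq> orth {y}" by (auto simp: orth_def polar_commute)
    then have "UNIV \<subseteq> orth {y}" unfolding C(3)[symmetric] by (rule span_minimal) simp
    then show "\<forall>z. polar N y z = 0" by (auto simp: orth_def)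
  qed
  then have "inj f" by (auto simp: f.inj_iff_eq_0)
  then have "surj f" using lf by (rule linear_inj_imp_surj[rotated])
  have "f ` orth W = span (C - B)"
  proof (intro equalityI subsetI)
    fix v assume "v \<in> f ` orth W"
    then obtain y where y: "y \<in> orth W" "v = f y" by blast
    have "polar N b y = 0" if "b \<in> B" for b using y B(2) that by (auto simp: orth_def)
    then have "scale (polar N c y) c \<in> span (C - B)" if "c \<in> C" for c
      using that by (cases "c \<in> B") (auto intro: span_scale span_base span_zero)
    then show "v \<in> span (C - B)" unfolding y f_def by (rule span_sum)
  next
    fix v assume v: "v \<in> span (C - B)"
    obtain y where y: "v = f y" using \<open>surj f\<close> by blast
    obtain u where "v = (\<Sum>c\<in>C - B. scale (u c) c)"
      using v fC span_finite[of "C - B"] by auto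
    also have "\<dots> = (\<Sum>c\<in>C. scale (if c \<in> B then 0 else u c) c)"
      using fC by (intro sum.mono_neutral_cong_left) auto
    finally have "(\<Sum>c\<in>C. scale (polar N c y - (if c \<in> B then 0 else u c)) c) = 0"
      using y by (simp add: f_def scale_left_diff_distrib sum_subtractf)
    then have "polar N c y - (if c \<in> B then 0 else u c) = 0" if "c \<in> C" for c
      by (rule independentD[OF C(2) fC order_refl]) (use that in auto)
    then have "B \<subseteq> orth {y}" using C(1) by (fastforce simp: orth_def polar_commute)
    then have "W \<subseteq> orth {y}" unfolding B(4)[symmetric] by (rule span_minimal) simp
    then have "y \<in> orth W" by (auto simp: orth_def polar_commute)
    then show "v \<in> f ` orth W" using y by blast
  qed
  moreover have "dim (f ` orth W) = dim (orth W)"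
    using \<open>inj f\<close> by (intro p.dim_image_eq[OF lf]) (auto simp: inj_on_def)
  moreover have "dim (span (C - B)) = card C - card B"
    using C B dim_span_eq_card_independent[OF independent_mono[OF C(2), of "C - B"]]
    by (simp add: card_Diff_subset)
  ultimately show ?thesis using B(5) cC card_mono[OF fC C(1)] by simp
qed

lemma orth_orth: "subspace W \<Longrightarrow> orth (orth W) = W"
  using dim_orth[of W] dim_orth[of "orth W", OF subspace_orth]
  by (intro subspace_dim_equal[symmetric] subspace_orth) (simp_all, auto simp: orth_def polar_commute)

lemma totally_singular_dim_le:
  assumes "totally_singular V" shows "dim V \<le> 4"
  using dim_orth[of V] dim_subset[OF totally_singular_subset_orth[OF assms]]
    totally_singularD(1)[OF assms] by simp

lemma totally_singular_dim_4_orth: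
  assumes "totally_singular V" "dim V = 4" shows "orth V = V"
  using dim_orth[of V] totally_singular_subset_orth[OF assms(1)] totally_singularD(1)[OF assms(1)] assms(2)
  by (intro subspace_dim_equal[symmetric]) auto

section \<open>Conjugation, the quadratic equation and the associator\<close>

lemma norm_one [simp]: "N one = 1"
proof (rule ccontr)
  \<comment> \<open>Then N(1) = 0, so N vanishes identically and non-degeneracy leaves only the zero
    space.\<close>
  assume *: "N one \<noteq> 1"
  have "N one * N one = N one" using norm_mult[of one one] by (simp add: one_mult)
  then have "N one = 0" using * by simp
  then have N0: "N x = 0" for x using norm_mult[of one x] by (simp add: one_mult)
  have "x = 0" for x :: 'b using polar_nondegenerate[of x] by (simp add: polar_def N0)
  then have "UNIV = {0::'b}" by blast
  then have "dim UNIV = 0" by (simp only: dim_eq_0 subset_refl)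
  then show False using dim_eq_8 by simp
qed

lemma trace_one [simp]: "trace one = 2"
  by (simp add: polar_same)

lemma one_neq_zero [simp]: "one \<noteq> 0"
  using norm_one norm_zero by (metis zero_neq_one)

lemma conjugate_zero [simp]: "conjugate 0 = 0"
  by (simp add: conjugate_def)

lemma trace_conjugate [simp]: "trace (conjugate x) = trace x"
  by (simp add: conjugate_def)

lemma conjugate_conjugate [simp]: "conjugate (conjugate x) = x"
  using trace_conjugate[of x] by (simp add: conjugate_def)

text \<open>Paired with any z, the left side of the first equation becomes (xy|xz) = N(x)(y|z) by
  adjointness; the second is symmetric.\<close>

lemma conjugate_mult_cancel:
  "mult (conjugate x) (mult x y) = scale (N x) y" "mult (mult y x) (conjugate x) = scale (N x) y"
  using polar_mult_left[of "conjugate x" "mult x y"] polar_mult_right[of "mult y x" "conjugate x"]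
  by (auto intro!: polar_eqI simp: polar_mult_mult)

lemma square: "mult x x = scale (trace x) x - scale (N x) one"
  using conjugate_mult_cancel(1)[of x one]
  by (simp add: conjugate_def one_mult mult_one algebra_simps)

lemma left_alternative: "mult x (mult x y) = mult (mult x x) y"
  using conjugate_mult_cancel(1)[of x y]
  by (simp add: conjugate_def square one_mult algebra_simps)

lemma right_alternative: "mult (mult y x) x = mult y (mult x x)"
  using conjugate_mult_cancel(2)[of y x]
  by (simp add: conjugate_def square mult_one algebra_simps)

text \<open>This is \<open>square\<close> linearized; orthogonal elements of trace 0 therefore
  anticommute.\<close>

lemma mult_swap:
  "mult y x = scale (trace x) y + scale (trace y) x - scale (polar N x y) one - mult x y"
proof -
  have "mult y x = mult (x + y) (x + y) - mult x x - mult y y - mult x y" by simp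
  also have "\<dots> = scale (trace x) y + scale (trace y) x - scale (polar N x y) one - mult x y"
    unfolding square by (simp add: norm_add algebra_simps)
  finally show ?thesis .
qed

lemma associator_linear [simp]:
  "associator (x + y) z w = associator x z w + associator y z w"
  "associator x (y + z) w = associator x y w + associator x z w"
  "associator x y (z + w) = associator x y z + associator x y w"
  "associator (x - y) z w = associator x z w - associator y z w"
  "associator x (y - z) w = associator x y w - associator x z w"
  "associator x y (z - w) = associator x y z - associator x y w"
  "associator (scale c x) y z = scale c (associator x y z)"
  "associator x (scale c y) z = scale c (associator x y z)"
  "associator x y (scale c z) = scale c (associator x y z)"
  "associator 0 y z = 0" "associator x 0 z = 0" "associator x y 0 = 0"
  by (simp_all add: associator_def algebra_simps)

lemma associator_one [simp]:
  "associator one y z = 0" "associator x one z = 0" "associator x y one = 0"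
  by (simp_all add: associator_def one_mult mult_one)

text \<open>Linearizing the two alternative laws makes the associator alternating.\<close>

lemma associator_swap:
  "associator y x z = - associator x y z" "associator x z y = - associator x y z"
  and associator_same [simp]: "associator x x z = 0" "associator x y y = 0" "associator x y x = 0"
proof -
  show xx: "associator x x z = 0" "associator x y y = 0" for x y z
    by (simp_all add: associator_def left_alternative right_alternative)
  show sw: "associator y x z = - associator x y z" "associator x z y = - associator x y z" for x y z
  proof -
    have "associator (x + y) (x + y) z = associator x x z + associator y y z + (associator x y z + associator y x z)"
      "associator x (y + z) (y + z) = associator x y y + associator x z z + (associator x y z + associator x z y)"
      by (simp_all add: algebra_simps)
    then show "associator y x z = - associator x y z" "associator x z y = - associator x y z"
      unfolding xx by (simp_all add: eq_neg_iff_add_eq_0 add.commute)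
  qed
  show "associator x y x = 0" using sw(2)[of x y x] xx by simp
qed

lemma associator_rotate: "associator y z x = associator x y z"
  by (metis associator_swap minus_minus)

lemma trace_mult: "trace (mult x y) = trace x * trace y - polar N x y"
  by (simp add: polar_mult_left mult_one conjugate_def polar_commute[of y])

text \<open>With t the trace of xy, both (xy)(xy) and x(y(xy)) equal t(xy) - N(x)N(y)1. For the
  second, \<open>mult_swap\<close> turns y(xy) into a combination of y and the conjugate of
  x.\<close>

lemma associator_mult [simp]: "associator x y (mult x y) = 0"
proof -
  have "mult y (mult x y) = mult y (scale (trace y) x + scale (trace x) y - scale (polar N x y) one - mult y x)"
    using mult_swap[of x y] polar_commute[of x y] by simp
  also have "\<dots> = scale (trace x * trace y - polar N x y) y - scale (N y) (conjugate x)"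
    by (simp add: left_alternative square conjugate_def one_mult mult_one algebra_simps)
  finally have *: "mult y (mult x y) = scale (trace x * trace y - polar N x y) y - scale (N y) (conjugate x)" .
  show ?thesis
    unfolding associator_def *
    by (simp add: square[of "mult x y"] square[of x] conjugate_def norm_mult trace_mult mult_one algebra_simps)
qed

lemma associative_on_iff: "associative_on mult S \<longleftrightarrow> (\<forall>x\<in>S. \<forall>y\<in>S. \<forall>z\<in>S. associator x y z = 0)"
  by (simp add: associative_on_def associator_def)

section \<open>Subalgebras of dimension at most 4\<close>

lemma subspace_associator_kernel:
  "subspace {z. associator x y z = 0}" "subspace {y. associator x y z = 0}"
  "subspace {x. associator x y z = 0}"
  by (auto simp: subspace_def)

lemma associator_span_eq_0:
  "(\<And>z. z \<in> A \<Longrightarrow> associator x y z = 0) \<Longrightarrow> z \<in> span A \<Longrightarrow> associator x y z = 0"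
  using span_minimal[OF _ subspace_associator_kernel(1), of A x y] by blast

lemma subspace_mult_kernel: "subspace {y. mult x y = 0}" "subspace {y. mult y x = 0}"
  by (auto simp: subspace_def)

lemma in_span_pairE:
  assumes "x \<in> span {a, b}" obtains p q where "x = scale p a + scale q b"
  using assms by (auto simp: span_insert span_singleton eq_diff_eq algebra_simps)

lemma in_span_tripleE:
  assumes "x \<in> span {a, b, c}"
  obtains p q r where "x = scale p a + scale q b + scale r c"
  using assms by (auto simp: span_insert span_singleton eq_diff_eq algebra_simps)

lemma subalgebra_totally_singular:
  assumes S: "subalgebra S" and "one \<notin> S"
  shows "totally_singular S"
proof (rule totally_singularI)
  show sub: "subspace S" using S by (simp add: subalgebra_def)
  fix x assume x: "x \<in> S"
  have "scale (N x) one = scale (trace x) x - mult x x" by (simp add: square)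
  also have "\<dots> \<in> S"
    using S x sub by (intro subspace_diff subspace_scale mult_closed)
  finally have "scale (inverse (N x)) (scale (N x) one) \<in> S" by (rule subspace_scale[OF sub])
  then show "N x = 0" using \<open>one \<notin> S\<close> by (cases "N x = 0") auto
qed

lemma dim_insert3:
  assumes "x \<noteq> 0" "y \<notin> span {x}" "z \<notin> span {y, x}"
  shows "dim {z, y, x} = 3"
  using assms by (simp add: dim_insert)

text \<open>Otherwise \<open>1, a, b, ab\<close> span \<open>S\<close>, so that \<open>c\<close> lies in the algebra generated by \<open>a\<close> and \<open>b\<close>,
  which is associative.\<close>

lemma associator_nonzero_mult_in_span:
  assumes S: "subalgebra S" "dim S \<le> 4" "one \<in> S"
    and abc: "a \<in> S" "b \<in> S" "c \<in> S" "associator a b c \<noteq> 0"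
  shows "mult a b \<in> span {one, a, b}"
proof (rule ccontr)
  assume "mult a b \<notin> span {one, a, b}"
  then have "mult a b \<notin> span {b, a, one}" by (simp add: insert_commute)
  moreover have "b \<notin> span {a, one}"
    using span_minimal[OF _ subspace_associator_kernel(2)[of a c], of "{a, one}"] abc(4) by auto
  moreover have "a \<notin> span {one}"
    using span_minimal[OF _ subspace_associator_kernel(3)[of b c], of "{one}"] abc(4) by auto
  ultimately have "dim (span {mult a b, b, a, one}) = 4"
    by (simp add: dim_insert)
  moreover have "span {mult a b, b, a, one} \<subseteq> S"
    using S abc by (intro span_minimal) (auto simp: subalgebra_def)
  ultimately have "span {mult a b, b, a, one} = S"
    using S by (intro subspace_dim_equal) (auto simp: subalgebra_def)
  then have "c \<in> span {mult a b, b, a, one}" using abc(3) by simp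
  then have "associator a b c = 0" by (rule associator_span_eq_0[rotated]) auto
  then show False using abc(4) by simp
qed

text \<open>Scalar shifts preserve the associator and turn ab into a scalar \<kappa>. If \<kappa>
  were non-zero, b' would be proportional to the conjugate of a' and the associator would vanish. So
  a'b' = 0, which forces N(a') = 0, and the associator is -a'(b'c).\<close>

lemma associator_nonzero_in_span:
  assumes S: "subalgebra S" "dim S \<le> 4" "one \<in> S"
    and abc: "a \<in> S" "b \<in> S" "c \<in> S" "associator a b c \<noteq> 0"
  shows "associator a b c \<in> span {one, a, c}" and "N (associator a b c) = 0"
proof -
  have sub: "subspace S" using S(1) by (simp add: subalgebra_def)
  obtain \<alpha> \<beta> \<gamma> where ab: "mult a b = scale \<alpha> one + scale \<beta> a + scale \<gamma> b"
    using associator_nonzero_mult_in_span[OF S abc] by (rule in_span_tripleE)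
  \<comment> \<open>The shifts complete the product: (a - \<gamma>)(b - \<beta>) = ab - \<beta>a -
    \<gamma>b + \<beta>\<gamma> = \<alpha> + \<beta>\<gamma>.\<close>
  define a' b' \<kappa> where "a' = a - scale \<gamma> one" and "b' = b - scale \<beta> one" and "\<kappa> = \<alpha> + \<beta> * \<gamma>"
  have S': "a' \<in> S" "b' \<in> S"
    using abc S(3) sub by (auto simp: a'_def b'_def intro!: subspace_diff subspace_scale)
  have w: "associator a' b' c = associator a b c" by (simp add: a'_def b'_def)
  have ab': "mult a' b' = scale \<kappa> one"
    by (simp add: a'_def b'_def \<kappa>_def ab one_mult mult_one algebra_simps)
  have Nb': "scale (N a') b' = scale \<kappa> (conjugate a')"
    using conjugate_mult_cancel(1)[of a' b'] by (simp add: ab' mult_one)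
  have "\<kappa> = 0"
  proof (rule ccontr)
    assume "\<kappa> \<noteq> 0"
    then have "N a' \<noteq> 0" using arg_cong[OF ab', of N] by (auto simp: norm_mult norm_scale)
    moreover have "scale (N a') (associator a' b' c) = associator a' (scale (N a') b') c" by simp
    then have "scale (N a') (associator a' b' c) = 0"
      unfolding Nb' by (simp add: conjugate_def)
    ultimately show False using w abc(4) by simp
  qed
  then have "N a' = 0" using Nb' w abc(4) by auto
  have w': "associator a b c = - mult a' (mult b' c)"
    using w ab' \<open>\<kappa> = 0\<close> by (simp add: associator_def)
  then show "N (associator a b c) = 0" by (simp add: norm_mult \<open>N a' = 0\<close>)
  \<comment> \<open>Permuting arguments makes the previous lemma apply to the pairs b', c and a', c.
    Multiplying the expression for b'c by a' kills its b' term.\<close>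
  have "associator b' c a' \<noteq> 0" "associator a' c b' \<noteq> 0"
    using w abc(4) associator_swap(2)[of a' c b'] by (auto simp: associator_rotate)
  then have "mult b' c \<in> span {one, b', c}" and ac: "mult a' c \<in> span {one, a', c}"
    using associator_nonzero_mult_in_span[OF S] S' abc(3) by blast+
  then obtain p q r where "mult b' c = scale p one + scale q b' + scale r c"
    by (blast elim: in_span_tripleE)
  then have "associator a b c = - (scale p a' + scale r (mult a' c))"
    unfolding w' by (simp add: ab' \<open>\<kappa> = 0\<close> mult_one)
  also have "\<dots> \<in> span {one, a', c}"
    using ac by (intro span_neg span_add span_scale) (auto intro: span_base)
  also have "\<dots> \<subseteq> span {one, a, c}"
    by (intro span_minimal) (auto simp: a'_def intro!: span_diff span_scale intro: span_base)
  finally show "associator a b c \<in> span {one, a, c}" .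
qed

text \<open>A non-zero associator w is invariant under rotation, so it lies in three spans at once.
  Applying the associators with a, b and with b, c to w = p1 + qa + rc gives r = q = 0, and p1 has
  norm 0 only for p = 0.\<close>

lemma unital_subalgebra_associative:
  assumes S: "subalgebra S" "dim S \<le> 4" "one \<in> S"
  shows "associative_on mult S"
proof -
  have "associator a b c = 0" if abc: "a \<in> S" "b \<in> S" "c \<in> S" for a b c
  proof (rule ccontr)
    define w where "w = associator a b c"
    assume "associator a b c \<noteq> 0"
    then have w: "associator a b c = w" "associator b c a = w" "associator c a b = w" "w \<noteq> 0"
      by (simp_all add: w_def associator_rotate)
    have span: "w \<in> span {one, a, c}" "w \<in> span {one, b, a}" "w \<in> span {one, c, b}"
      and N: "N w = 0"
      using associator_nonzero_in_span[OF S] abc w by metis+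
    obtain p q r where pqr: "w = scale p one + scale q a + scale r c"
      using span(1) by (rule in_span_tripleE)
    have "associator a b w = 0"
      using span(2) by (rule associator_span_eq_0[rotated]) auto
    moreover have "associator a b (scale p one + scale q a + scale r c) = scale r w"
      by (simp add: w)
    ultimately have "scale r w = 0" unfolding pqr[symmetric] by simp
    then have "r = 0" using w(4) by simp
    have "associator b c w = 0"
      using span(3) by (rule associator_span_eq_0[rotated]) auto
    moreover have "associator b c (scale p one + scale q a + scale r c) = scale q w"
      by (simp add: w)
    ultimately have "scale q w = 0" unfolding pqr[symmetric] by simp
    then have "q = 0" using w(4) by simp
    have "w = scale p one" using pqr \<open>r = 0\<close> \<open>q = 0\<close> by simp
    then show False using N w(4) by (simp add: norm_scale)
  qed
  then show ?thesis by (auto simp: associative_on_iff)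
qed

lemma subalgebra_dim_less_4_associative:
  assumes S: "subalgebra S" "dim S < 4"
  shows "associative_on mult S"
proof -
  have sub: "subspace S" using S by (simp add: subalgebra_def)
  have "subalgebra (span (insert one S))"
    unfolding subalgebra_def
  proof (intro conjI ballI)
    fix x y assume "x \<in> span (insert one S)" "y \<in> span (insert one S)"
    then obtain k l where k: "x - scale k one \<in> S" and l: "y - scale l one \<in> S"
      using sub by (auto simp: span_breakdown_eq dest: span_eq_iff[THEN iffD2])
    define s t where "s = x - scale k one" and "t = y - scale l one"
    have xy: "x = s + scale k one" "y = t + scale l one" by (simp_all add: s_def t_def)
    have "s \<in> S" "t \<in> S" using k l by (simp_all only: s_def t_def)
    then have st: "mult s t \<in> S" "s \<in> S" "t \<in> S" using S(1) mult_closed by auto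
    show "mult x y \<in> span (insert one S)"
      unfolding xy using st
      by (auto simp: one_mult mult_one intro!: span_add span_scale intro: span_base)
  qed simp
  moreover have "dim (span (insert one S)) \<le> 4"
    using S by (simp add: dim_insert)
  ultimately have "associative_on mult (span (insert one S))"
    by (rule unital_subalgebra_associative) (simp add: span_base)
  then show ?thesis by (auto simp: associative_on_def intro: span_base)
qed

section \<open>Totally singular subalgebras\<close>

lemma mult_eq_0_norm:
  assumes "mult x y = 0" shows "x = 0 \<or> N y = 0" "y = 0 \<or> N x = 0"
  using conjugate_mult_cancel(2)[of x y] conjugate_mult_cancel(1)[of x y] assms by auto

lemma orth_span: "orth (span W) = orth W"
proof (intro equalityI subsetI)
  fix y assume "y \<in> orth W"
  then have "W \<subseteq> orth {y}" by (auto simp: orth_def polar_commute)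
  then have "span W \<subseteq> orth {y}" by (rule span_minimal) simp
  then show "y \<in> orth (span W)" by (auto simp: orth_def polar_commute)
qed (auto simp: orth_def intro: span_base)

lemma dim_orth_singleton: "x \<noteq> 0 \<Longrightarrow> dim (orth {x}) = 7"
  using dim_orth[of "span {x}"] by (simp add: orth_span)

lemma totally_singular_kernel:
  "x \<noteq> 0 \<Longrightarrow> totally_singular {y. mult x y = 0}"
  by (rule totally_singularI[OF subspace_mult_kernel(1)]) (auto dest: mult_eq_0_norm(1))

text \<open>For singular x the product xy is singular, and its trace is the polar form of y with the
  conjugate of x. The y that make this trace 0 form a space of dimension 7, too large for the kernel
  of multiplication by x, which is totally singular.\<close>

lemma ex_square_zero:
  assumes "norm_split N"
  shows "\<exists>n. mult n n = 0 \<and> n \<noteq> 0"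
proof -
  obtain x where x: "x \<noteq> 0" "N x = 0" using assms by (auto simp: norm_split_def)
  have "conjugate x \<noteq> 0" using x(1) conjugate_conjugate[of x] by (metis conjugate_zero)
  then have "dim (orth {conjugate x}) = 7" by (rule dim_orth_singleton)
  then have "\<not> orth {conjugate x} \<subseteq> {y. mult x y = 0}"
    using totally_singular_dim_le[OF totally_singular_kernel[OF x(1)]] dim_subset[of "orth {conjugate x}" "{y. mult x y = 0}"] by fastforce
  then obtain y where y: "polar N (conjugate x) y = 0" "mult x y \<noteq> 0"
    by (auto simp: orth_def)
  then have "trace (mult x y) = 0"
    by (simp add: polar_mult_left mult_one polar_commute[of y])
  then show ?thesis using y x(2) square[of "mult x y"] by (auto simp: norm_mult)
qed

lemma square_zeroD:
  assumes "mult n n = 0" "n \<noteq> 0"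
  shows "N n = 0" "trace n = 0"
proof -
  show "N n = 0" using arg_cong[OF assms(1), of N] by (simp add: norm_mult)
  then show "trace n = 0" using assms square[of n] by simp
qed

section \<open>The subspaces n\<O> with n of square zero\<close>

context
  fixes n assumes nn: "mult n n = 0" and n0: "n \<noteq> 0"
begin

text \<open>Image and kernel are both totally singular, so each has dimension at most 4, while the
  dimensions add up to 8.\<close>

lemma dim_range_mult_kernel: "dim (range (mult n)) = 4" "dim {x. mult n x = 0} = 4"
proof -
  have l: "Vector_Spaces.linear scale scale (mult n)" by (rule linear_mult_left)
  have "totally_singular (range (mult n))"
    using module_hom.subspace_image[OF module_hom_iff_linear[THEN iffD2, OF l] subspace_UNIV] square_zeroD(1)[OF nn n0]
    by (auto intro!: totally_singularI simp: norm_mult)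
  then have "dim (range (mult n)) \<le> 4" by (rule totally_singular_dim_le)
  moreover have "dim {x. mult n x = 0} \<le> 4"
    by (rule totally_singular_dim_le[OF totally_singular_kernel[OF n0]])
  moreover have "dim (range (mult n)) + dim {x. mult n x = 0} = 8"
    using rank_nullity[OF l subspace_UNIV] dim_eq_8 by simp
  ultimately show "dim (range (mult n)) = 4" "dim {x. mult n x = 0} = 4" by auto
qed

lemma range_mult_eq_kernel: "range (mult n) = {x. mult n x = 0}"
proof (rule subspace_dim_equal)
  show "subspace (range (mult n))"
    using module_hom.subspace_image[OF module_hom_iff_linear[THEN iffD2, OF linear_mult_left] subspace_UNIV] .
qed (use nn dim_range_mult_kernel in \<open>auto simp: left_alternative subspace_mult_kernel\<close>)

lemma totally_singular_range_mult: "totally_singular (range (mult n))"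
  unfolding range_mult_eq_kernel by (rule totally_singular_kernel) fact

text \<open>Swapping x and u in the associator turns (nx)u into n(xu + ux), and
  \<open>mult_swap\<close> evaluates xu + ux.\<close>

lemma range_mult_mult:
  assumes "mult n u = 0"
  shows "mult (mult n x) u = scale (trace u) (mult n x) - scale (polar N x u) n"
proof -
  have "mult (mult n x) u = associator n x u + mult n (mult x u)" by (simp add: associator_def)
  also have "associator n x u = - associator n u x" by (rule associator_swap)
  also have "\<dots> = mult n (mult u x)" using assms by (simp add: associator_def)
  also have "mult u x = scale (trace x) u + scale (trace u) x - scale (polar N x u) one - mult x u"
    by (rule mult_swap)
  finally show ?thesis using assms by (simp add: mult_one)
qed

lemma subalgebra_range_mult: "subalgebra (range (mult n))"
  unfolding subalgebra_def
proof (intro conjI ballI)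
  show "subspace (range (mult n))" using totally_singular_range_mult by (rule totally_singularD)
  fix y u assume "y \<in> range (mult n)" "u \<in> range (mult n)"
  then obtain x where x: "y = mult n x" "mult n u = 0" by (auto simp: left_alternative nn)
  show "mult y u \<in> range (mult n)"
    unfolding x range_mult_mult[OF x(2)] range_mult_eq_kernel
    using nn by (simp add: left_alternative)
qed

end

text \<open>As \<open>one\<close> has norm 1, it is outside V, which equals \<open>orth V\<close>;
  so the trace is a non-zero functional on V.\<close>

lemma trace_kernel:
  assumes V: "totally_singular V" "dim V = 4"
  obtains e where "e \<in> V" "trace e = 1" "dim {x \<in> V. trace x = 0} = 3"
proof -
  have sub: "subspace V" using V by (simp add: totally_singularD)
  have "one \<notin> V" using totally_singularD(2)[OF V(1), of one] by auto
  then have "one \<notin> orth V" using totally_singular_dim_4_orth[OF V] by simp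
  then obtain x where x: "x \<in> V" "trace x \<noteq> 0" by (auto simp: orth_def)
  define e where "e = scale (inverse (trace x)) x"
  have e: "e \<in> V" "trace e = 1" using x sub by (auto simp: e_def intro: subspace_scale)
  \<comment> \<open>The trace is encoded as a multiple of \<open>one\<close> because
    \<open>rank_nullity\<close> concerns maps of the space into itself.\<close>
  have l: "Vector_Spaces.linear scale scale (\<lambda>x. scale (trace x) one)"
    by unfold_locales (simp_all add: scale_left_distrib)
  have "dim ((\<lambda>x. scale (trace x) one) ` V) + dim {x \<in> V. scale (trace x) one = 0} = 4"
    using rank_nullity[OF l sub] V(2) by simp
  moreover have "(\<lambda>x. scale (trace x) one) ` V = span {one}"
  proof (intro equalityI subsetI)
    fix y assume "y \<in> span {one}"
    then obtain k where "y = scale k one" by (auto simp: span_singleton)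
    then have "y = scale (trace (scale k e)) one" using e(2) by simp
    moreover have "scale k e \<in> V" using sub e(1) by (rule subspace_scale)
    ultimately show "y \<in> (\<lambda>x. scale (trace x) one) ` V" by blast
  qed (auto simp: span_singleton)
  ultimately have "dim {x \<in> V. trace x = 0} = 3" by simp
  then show thesis using that e by blast
qed

lemma subspace_trace_kernel: "subspace V \<Longrightarrow> subspace {x \<in> V. trace x = 0}"
  by (auto simp: subspace_def)

text \<open>For a of trace 1 and suitable u, v of trace 0, uv is a non-zero multiple of n and an =
  n, so a(uv) is non-zero. But au is a multiple of n, so (au)v = 0.\<close>

lemma range_mult_not_associative:
  assumes nn: "mult n n = 0" and n0: "n \<noteq> 0"
  shows "\<not> associative_on mult (range (mult n))"
proof
  let ?K = "range (mult n)"
  assume assoc: "associative_on mult ?K"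
  note ts = totally_singular_range_mult[OF nn n0] and ker = range_mult_eq_kernel[OF nn n0]
  let ?L = "{x \<in> ?K. trace x = 0}"
  obtain a where a: "a \<in> ?K" "trace a = 1" and K0: "dim ?L = 3"
    using trace_kernel[OF ts dim_range_mult_kernel(1)[OF nn n0]] .
  have sub: "subspace ?L" using ts by (intro subspace_trace_kernel totally_singularD)
  \<comment> \<open>Comparing dimensions 7 and 5 yields y orthogonal to n, so that ny has trace 0,
    but not orthogonal to all of \<open>?L\<close>.\<close>
  have "dim (orth ?L) = 5" using dim_orth[OF sub] K0 by simp
  then have "\<not> orth {n} \<subseteq> orth ?L"
    using dim_orth_singleton[OF n0] dim_subset[of "orth {n}" "orth ?L"] by fastforce
  then obtain y v where y: "polar N n y = 0" and v: "v \<in> ?K" "trace v = 0" "polar N v y \<noteq> 0"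
    by (auto simp: orth_def)
  define u where "u = mult n y"
  have u: "u \<in> ?K" "trace u = 0"
    using y square_zeroD[OF nn n0] by (auto simp: u_def trace_mult)
  obtain x where x: "a = mult n x" using a by blast
  have nv: "mult n v = 0" "mult n u = 0" "mult n a = 0" using u(1) v(1) a(1) unfolding ker by blast+
  have "mult u v = - scale (polar N v y) n"
    unfolding u_def using range_mult_mult[OF nn n0 nv(1)] v by (simp add: polar_commute)
  moreover have "mult a n = n"
  proof -
    have "n \<in> range (mult n)" unfolding ker using nn by blast
    then have "polar N n a = 0" using totally_singular_polar[OF ts _ a(1)] by blast
    then show ?thesis
      unfolding mult_swap[of a n] using a(2) nv(3) square_zeroD(2)[OF nn n0] by simp
  qed
  ultimately have "mult a (mult u v) = - scale (polar N v y) n" by simp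
  moreover have "mult (mult a u) v = 0"
    unfolding x using range_mult_mult[OF nn n0 nv(2)] u nv by simp
  moreover have "mult (mult a u) v = mult a (mult u v)"
    using assoc a u v unfolding associative_on_def by blast
  ultimately show False using v n0 by simp
qed

end

section \<open>The subspaces \<O>n and the subalgebras of dimension 4\<close>

lemma associative_on_opposite:
  "associative_on (\<lambda>x y. mult y x) S \<longleftrightarrow> associative_on mult S"
  unfolding associative_on_def by metis

context octonion_algebra
begin

context
  fixes n assumes nn: "mult n n = 0" and n0: "n \<noteq> 0"
begin

interpretation opposite: octonion_algebra scale "\<lambda>x y. mult y x" N one
  by (rule octonion_algebra_opposite)

lemma range_mult_right_eq_kernel: "range (\<lambda>x. mult x n) = {x. mult x n = 0}"
  using opposite.range_mult_eq_kernel[OF nn n0] .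

lemma dim_range_mult_right: "dim (range (\<lambda>x. mult x n)) = 4"
  using opposite.dim_range_mult_kernel(1)[OF nn n0] .

lemma totally_singular_range_mult_right: "totally_singular (range (\<lambda>x. mult x n))"
  using opposite.totally_singular_range_mult[OF nn n0] .

lemma subalgebra_range_mult_right: "subalgebra (range (\<lambda>x. mult x n))"
  using opposite.subalgebra_range_mult[OF nn n0]
  by (auto simp: subalgebra_def opposite.subalgebra_def)

lemma range_mult_right_not_associative: "\<not> associative_on mult (range (\<lambda>x. mult x n))"
  using opposite.range_mult_not_associative[OF nn n0] associative_on_opposite by metis

end

text \<open>Otherwise \<open>V\<^sub>0\<close> would be contained in \<open>{v. nv = 0} = n\<O>\<close>, and the multiplication of
  \<open>n\<O>\<close> shows that \<open>{x. nx \<in> V\<^sub>0}\<close>, of dimension 7, is orthogonal to \<open>V\<^sub>0\<close>.\<close>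

lemma trace_kernel_mult_nonzero:
  assumes V0: "subspace V\<^sub>0" "dim V\<^sub>0 = 3" and V: "\<And>x. x \<in> V\<^sub>0 \<Longrightarrow> mult x x = 0"
  shows "\<exists>a\<in>V\<^sub>0. \<exists>b\<in>V\<^sub>0. mult a b \<noteq> 0"
proof (rule ccontr)
  assume "\<not> ?thesis"
  then have zero: "mult a b = 0" if "a \<in> V\<^sub>0" "b \<in> V\<^sub>0" for a b using that by blast
  have "\<not> V\<^sub>0 \<subseteq> {0}" using V0(2) by (metis dim_eq_0 zero_neq_numeral)
  then obtain n where n: "n \<in> V\<^sub>0" "n \<noteq> 0" by blast
  then have nn: "mult n n = 0" using V by blast
  let ?X = "{x. mult n x \<in> V\<^sub>0}"
  interpret f: Vector_Spaces.linear scale scale "mult n" by (rule linear_mult_left)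
  have X: "subspace ?X" using V0(1) by (rule f.subspace_linear_preimage)
  have "V\<^sub>0 \<subseteq> range (mult n)"
    unfolding range_mult_eq_kernel[OF nn n(2)] using zero n by blast
  then have "mult n ` ?X = V\<^sub>0" by blast
  moreover have "{x \<in> ?X. mult n x = 0} = {x. mult n x = 0}"
    using subspace_0[OF V0(1)] by auto
  ultimately have "dim ?X = 7"
    using rank_nullity[OF linear_mult_left[of n] X] V0(2) dim_range_mult_kernel[OF nn n(2)] by simp
  moreover have "?X \<subseteq> orth V\<^sub>0"
  proof
    fix x assume x: "x \<in> ?X"
    have "polar N u x = 0" if u: "u \<in> V\<^sub>0" for u
    proof -
      have "trace u = 0 \<or> u = 0" using square_zeroD V u by blast
      moreover have "mult n u = 0" "mult (mult n x) u = 0" using zero n(1) u x by auto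
      ultimately show ?thesis
        using range_mult_mult[OF nn n(2), of u x] n(2) by (auto simp: polar_commute)
    qed
    then show "x \<in> orth V\<^sub>0" by (simp add: orth_def)
  qed
  then have "dim ?X \<le> dim (orth V\<^sub>0)" by (rule dim_subset)
  ultimately show False using dim_orth[OF V0(1)] V0(2) by linarith
qed

lemma totally_singular_subalgebra_form:
  assumes S: "subalgebra S" "totally_singular S" "dim S = 4"
  shows "\<exists>n. mult n n = 0 \<and> n \<noteq> 0 \<and> (S = range (\<lambda>x. mult n x) \<or> S = range (\<lambda>x. mult x n))"
proof -
  have sub: "subspace S" using S by (simp add: totally_singularD)
  define V where "V = {x \<in> S. trace x = 0}"
  obtain e where e: "e \<in> S" "trace e = 1" and dV: "dim V = 3"
    unfolding V_def using trace_kernel[OF S(2,3)] .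
  have V: "subspace V" unfolding V_def using sub by (rule subspace_trace_kernel)
  have ts: "polar N x y = 0" if "x \<in> S" "y \<in> S" for x y
    using totally_singular_polar[OF S(2)] that .
  have N: "N x = 0" if "x \<in> S" for x
    using totally_singularD(2)[OF S(2) that] .
  have VS: "x \<in> S" "trace x = 0" if "x \<in> V" for x using that by (auto simp: V_def)
  \<comment> \<open>The polar form vanishes on S, so the trace is multiplicative there by
    \<open>trace_mult\<close>, and its kernel V is an ideal of S.\<close>
  have mV: "mult x y \<in> V" if "x \<in> S" "y \<in> S" "x \<in> V \<or> y \<in> V" for x y
  proof -
    have "trace x * trace y = 0" using that(3) VS(2) by auto
    then have "trace (mult x y) = 0" using ts that by (simp add: trace_mult)
    then show ?thesis using mult_closed[OF S(1)] that by (simp add: V_def)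
  qed
  have sq: "mult x x = 0" if "x \<in> V" for x using VS[OF that] N by (simp add: square)
  have swap: "mult y x = - mult x y" if "x \<in> V" "y \<in> V" for x y
    unfolding mult_swap[of y x] using VS that ts by simp
  obtain a b where ab: "a \<in> V" "b \<in> V" "mult a b \<noteq> 0"
    using trace_kernel_mult_nonzero[OF V dV sq] by blast
  define n where "n = mult a b"
  have n: "n \<in> V" "n \<noteq> 0" using ab mV[of a b] VS(1) by (simp_all add: n_def)
  have an: "mult a n = 0" "mult n b = 0"
    using ab sq by (simp_all add: n_def left_alternative right_alternative)
  then have na: "mult n a = 0" "mult b n = 0"
    using swap[of a n] swap[of n b] ab n by auto
  have "a \<noteq> 0" using ab by auto
  moreover have "b \<notin> span {a}" using ab sq[of a] by (auto simp: span_singleton)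
  moreover have "n \<notin> span {b, a}"
  proof
    assume "n \<in> span {b, a}"
    then obtain p q where pq: "n = scale p b + scale q a" by (rule in_span_pairE)
    \<comment> \<open>Multiplying n = pb + qa by a on the left, or by b on the right, isolates one
      coefficient.\<close>
    have "mult a n = scale p n" "mult n b = scale q n"
      unfolding n_def[symmetric] by (subst pq, simp add: sq ab n_def)+
    then have "p = 0" "q = 0" using an n(2) by auto
    then show False using n(2) pq by simp
  qed
  ultimately have "dim {n, b, a} = 3" by (rule dim_insert3)
  then have "span {n, b, a} = V"
    using n ab V dV by (intro subspace_dim_equal span_minimal) auto
  moreover have "span {n, b, a} \<subseteq> {x. mult n x = 0}"
    by (rule span_minimal[OF _ subspace_mult_kernel(1)]) (use an na sq[OF n(1)] in simp)
  moreover have "span {n, b, a} \<subseteq> {x. mult x n = 0}"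
    by (rule span_minimal[OF _ subspace_mult_kernel(2)]) (use an na sq[OF n(1)] in simp)
  ultimately have nV: "mult n v = 0" "mult v n = 0" if "v \<in> V" for v
    using that by blast+
  \<comment> \<open>V and e span S. Containment in an annihilator of dimension 4 will then give
    equality.\<close>
  have S_sub: "S \<subseteq> W" if W: "subspace W" "e \<in> W" "V \<subseteq> W" for W
  proof
    fix x assume "x \<in> S"
    then have "x - scale (trace x) e \<in> V"
      using e sub by (auto simp: V_def intro: subspace_diff subspace_scale)
    then have "(x - scale (trace x) e) + scale (trace x) e \<in> W"
      using W by (intro subspace_add subspace_scale) auto
    then show "x \<in> W" by simp
  qed
  have ee: "mult e e = e" using e N by (simp add: square)
  show ?thesis
  proof (cases "mult e n = 0")
    case True
    then have "S \<subseteq> {x. mult x n = 0}" by (intro S_sub subspace_mult_kernel) (auto simp: nV)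
    then have "S = range (\<lambda>x. mult x n)"
      unfolding range_mult_right_eq_kernel[OF sq[OF n(1)] n(2), symmetric]
      using S(3) dim_range_mult_right[OF sq[OF n(1)] n(2)] sub
        totally_singularD(1)[OF totally_singular_range_mult_right[OF sq[OF n(1)] n(2)]]
      by (intro subspace_dim_equal) auto
    then show ?thesis using n(2) sq[OF n(1)] by (intro exI[of _ n]) simp
  next
    case False
    \<comment> \<open>Here ne = n - m and em = m, so me = e(ne) = e(n - m) = 0.\<close>
    define m where "m = mult e n"
    have m: "m \<in> V" "m \<noteq> 0" using False mV[of e n] e n VS(1) by (simp_all add: m_def)
    have "mult n e = n - m"
      unfolding mult_swap[of n e] using e n(1) VS ts by (simp add: m_def)
    moreover have "mult m e = mult e (mult n e)"
      using associator_same(3)[where x = e and y = n] unfolding associator_def m_def by simp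
    moreover have "mult e m = m" by (simp add: m_def left_alternative ee)
    ultimately have "mult m e = 0" by (simp add: m_def)
    moreover have "mult m v = 0" if v: "v \<in> V" for v
    proof -
      \<comment> \<open>After rotation both terms of the associator contain n times an element of
        V.\<close>
      have "mult m v = associator e n v" using nV v by (simp add: associator_def m_def)
      also have "\<dots> = associator n v e" by (simp add: associator_rotate)
      also have "\<dots> = 0" using nV(1)[OF v] nV(1)[OF mV[of v e]] v e VS(1) by (simp add: associator_def)
      finally show ?thesis .
    qed
    ultimately have "S \<subseteq> {x. mult m x = 0}" by (intro S_sub subspace_mult_kernel) auto
    then have "S = range (mult m)"
      unfolding range_mult_eq_kernel[OF sq[OF m(1)] m(2), symmetric]
      using S(3) dim_range_mult_kernel(1)[OF sq[OF m(1)] m(2)] sub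
        totally_singularD(1)[OF totally_singular_range_mult[OF sq[OF m(1)] m(2)]]
      by (intro subspace_dim_equal) auto
    then show ?thesis using m(2) sq[OF m(1)] by (intro exI[of _ m]) simp
  qed
qed

lemma totally_singular_subalgebra_iff:
  "subalgebra S \<and> dim S = 4 \<and> totally_singular S \<longleftrightarrow>
    (\<exists>n. mult n n = 0 \<and> n \<noteq> 0 \<and> (S = range (\<lambda>x. mult n x) \<or> S = range (\<lambda>x. mult x n)))"
proof (intro iffI; elim exE conjE)
  fix n assume n: "mult n n = 0" "n \<noteq> 0"
    and "S = range (\<lambda>x. mult n x) \<or> S = range (\<lambda>x. mult x n)"
  then show "subalgebra S \<and> dim S = 4 \<and> totally_singular S"
    using subalgebra_range_mult[OF n] subalgebra_range_mult_right[OF n]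
      dim_range_mult_kernel(1)[OF n] dim_range_mult_right[OF n]
      totally_singular_range_mult[OF n] totally_singular_range_mult_right[OF n] by metis
qed (rule totally_singular_subalgebra_form)

text \<open>With \<open>one\<close> in S associativity is known; without it S is totally singular.
  Conversely, a totally singular S is n\<O> or \<O>n.\<close>

lemma subalgebra_dim_4_not_associative_iff:
  assumes "subalgebra S" "dim S = 4"
  shows "\<not> associative_on mult S \<longleftrightarrow> totally_singular S"
proof
  assume "\<not> associative_on mult S"
  then show "totally_singular S"
    using assms unital_subalgebra_associative[of S] subalgebra_totally_singular[of S] by auto
next
  assume "totally_singular S"
  then obtain n where n: "mult n n = 0" "n \<noteq> 0"
    and "S = range (\<lambda>x. mult n x) \<or> S = range (\<lambda>x. mult x n)"
    using totally_singular_subalgebra_form[OF assms(1) _ assms(2)] by metis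
  then show "\<not> associative_on mult S"
    using range_mult_not_associative[OF n] range_mult_right_not_associative[OF n] by metis
qed

section \<open>Maximal totally singular subspaces\<close>

lemma totally_singular_extend:
  assumes U: "totally_singular U" "dim U = 4" and V: "totally_singular V" "dim V < 4"
  shows "\<exists>w. w \<notin> V \<and> N w = 0 \<and> (\<forall>v\<in>V. polar N v w = 0)"
proof (rule ccontr)
  assume none: "\<not> ?thesis"
  have sub: "subspace U" "subspace V" using U V by (auto dest: totally_singularD)
  let ?W = "{x + y |x y. x \<in> U \<and> y \<in> V}"
  have W: "subspace ?W" using sub by (rule subspace_sums)
  have "U \<subseteq> ?W" "V \<subseteq> ?W" using subspace_0[OF sub(1)] subspace_0[OF sub(2)] by force+
  \<comment> \<open>Vectors orthogonal to U + V lie in U, hence are singular; if none extends V,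
    they all lie in U \<inter> V. But 8 - dim (U + V) exceeds dim (U \<inter> V), because 4 + dim V
    < 8.\<close>
  then have "orth ?W \<subseteq> orth U" "orth ?W \<subseteq> orth V" by (simp_all only: orth_antimono)
  then have "orth ?W \<subseteq> U" "orth ?W \<subseteq> orth V" using totally_singular_dim_4_orth[OF U] by auto
  then have "orth ?W \<subseteq> U \<inter> V"
    using none totally_singularD(2)[OF U(1)] unfolding orth_def[of V] by blast
  then have "dim (orth ?W) \<le> dim (U \<inter> V)" by (rule dim_subset)
  then show False using dim_sums_Int[OF sub] dim_orth[OF W] U(2) V(2) by linarith
qed

lemma maximal_totally_singular_iff:
  assumes "norm_split N"
  shows "maximal_totally_singular V \<longleftrightarrow> totally_singular V \<and> dim V = 4"
proof
  obtain n where n: "mult n n = 0" "n \<noteq> 0" using ex_square_zero[OF assms] by blast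
  assume max: "maximal_totally_singular V"
  then have V: "totally_singular V" by (simp add: maximal_totally_singular_def)
  have "\<not> dim V < 4"
  proof
    assume "dim V < 4"
    then obtain w where w: "w \<notin> V" "N w = 0" "\<And>v. v \<in> V \<Longrightarrow> polar N v w = 0"
      using totally_singular_extend[OF totally_singular_range_mult[OF n] dim_range_mult_kernel(1)[OF n] V]
      by blast
    then have "span (insert w V) = V"
      using totally_singular_span_insert[OF V w(2,3)] max span_superset[of "insert w V"]
      unfolding maximal_totally_singular_def by blast
    then show False using w(1) span_base[of w "insert w V"] by auto
  qed
  then show "totally_singular V \<and> dim V = 4" using totally_singular_dim_le[OF V] V by simp
next
  assume V: "totally_singular V \<and> dim V = 4"
  have "W = V" if "totally_singular W" "V \<subseteq> W" for W
    using that V totally_singular_dim_le[of W] by (intro subspace_dim_equal[symmetric]) (auto dest: totally_singularD)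
  then show "maximal_totally_singular V" using V by (simp add: maximal_totally_singular_def)
qed

section \<open>Subalgebras of dimension greater than 4\<close>

text \<open>Adjointness moves s to the other side as its conjugate, which is in S because
  \<open>one\<close> is.\<close>

lemma orth_mult:
  assumes S: "subalgebra S" "one \<in> S" and "s \<in> S" "p \<in> orth S"
  shows "mult s p \<in> orth S" "mult p s \<in> orth S"
proof -
  have "conjugate s \<in> S"
    using assms by (auto simp: conjugate_def subalgebra_def intro!: subspace_diff subspace_scale)
  then have "mult (conjugate s) t \<in> S" "mult t (conjugate s) \<in> S" if "t \<in> S" for t
    using that S mult_closed by auto
  then have "polar N (mult s p) t = 0" "polar N (mult p s) t = 0" if "t \<in> S" for t
    using that assms(4) by (simp_all add: polar_mult_left[of s] polar_mult_right[of p] orth_def polar_commute[of p])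
  then show "mult s p \<in> orth S" "mult p s \<in> orth S"
    by (simp_all add: orth_def polar_commute)
qed

text \<open>The last assumption excludes the whole of a non-split algebra, where 0 is the only
  singular vector.\<close>

lemma totally_singular_subalgebra_exists:
  assumes S: "subalgebra S" "dim S > 4" and "norm_split N \<or> S \<noteq> UNIV"
  shows "\<exists>T. subalgebra T \<and> T \<subseteq> S \<and> dim T = 4 \<and> totally_singular T"
proof (cases "S = UNIV")
  case True
  then obtain n where n: "mult n n = 0" "n \<noteq> 0" using assms(3) ex_square_zero by blast
  then show ?thesis
    using True subalgebra_range_mult dim_range_mult_kernel(1) totally_singular_range_mult by blast
next
  case False
  have sub: "subspace S" using S by (simp add: subalgebra_def)
  have one: "one \<in> S"
    using subalgebra_totally_singular[OF S(1)] totally_singular_dim_le S(2) by fastforce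
  let ?P = "orth S"
  have dim: "dim S + dim ?P = 8" using dim_orth[OF sub] .
  have lin: "Vector_Spaces.linear scale scale (\<lambda>s. mult s p)" for p by (rule linear_mult_right)
  have kernel: "dim S \<le> dim ?P + dim {s \<in> S. mult s p = 0}" if "p \<in> ?P" for p
  proof -
    have "(\<lambda>s. mult s p) ` S \<subseteq> ?P" using orth_mult[OF S(1) one] that by blast
    then have "dim ((\<lambda>s. mult s p) ` S) \<le> dim ?P" by (rule dim_subset)
    then show ?thesis using rank_nullity[OF lin sub, of p] by linarith
  qed
  have N: "N p = 0" if p: "p \<in> ?P" for p
  proof (rule ccontr)
    assume "N p \<noteq> 0"
    \<comment> \<open>Now s \<mapsto> sp is injective on S, so dim S is at most 8 - dim S, against
      dim S > 4.\<close>
    then have "{s \<in> S. mult s p = 0} \<subseteq> {0}" using mult_eq_0_norm by blast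
    then have "dim {s \<in> S. mult s p = 0} = 0" by simp
    then show False using kernel[OF p] dim S(2) by linarith
  qed
  have P: "totally_singular ?P" using N by (intro totally_singularI) auto
  have "dim ?P \<noteq> 0"
  proof
    assume "dim ?P = 0"
    then have "dim S = 8" using dim by linarith
    then have "S = UNIV" using sub dim_eq_8 by (intro subspace_dim_equal) simp_all
    then show False using False by simp
  qed
  then have "\<not> ?P \<subseteq> {0}" by (simp only: dim_eq_0) simp
  then obtain n where n: "n \<in> ?P" "n \<noteq> 0" by blast
  have "trace n = 0" using n(1) one by (auto simp: orth_def polar_commute)
  then have nn: "mult n n = 0" using N[OF n(1)] by (simp add: square)
  show ?thesis
  proof (cases "dim S = 5")
    case True
    then have dP: "dim ?P = 3" using dim by simp
    \<comment> \<open>The kernel bound gives only 5 - 3 = 2 here, so \<open>?P\<close> is enlarged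
      instead.\<close>
    obtain w where w: "w \<notin> ?P" "N w = 0" "\<And>v. v \<in> ?P \<Longrightarrow> polar N v w = 0"
      using totally_singular_extend[OF totally_singular_range_mult[OF nn n(2)]
        dim_range_mult_kernel(1)[OF nn n(2)] P] dP by auto
    let ?T = "span (insert w ?P)"
    have ts: "totally_singular ?T" using P w(2,3) by (rule totally_singular_span_insert)
    have span_P: "span ?P = ?P" by simp
    have dT: "dim ?T = 4" using w(1) dP by (simp add: dim_insert span_P)
    have "insert w ?P \<subseteq> orth ?P"
      using w(3) totally_singular_subset_orth[OF P] by (simp add: orth_def[of ?P])
    then have "?T \<subseteq> orth ?P" by (rule span_minimal) simp
    then have TS: "?T \<subseteq> S" using orth_orth[OF sub] by simp
    have "mult x y \<in> ?T" if xyT: "x \<in> ?T" "y \<in> ?T" for x y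
    proof -
      obtain k l where k: "x - scale k w \<in> ?P" and l: "y - scale l w \<in> ?P"
        using xyT unfolding span_breakdown_eq span_P by blast
      define p q where "p = x - scale k w" and "q = y - scale l w"
      have pq: "p \<in> ?P" "q \<in> ?P" using k l by (simp_all only: p_def q_def)
      have xy: "x = p + scale k w" "y = q + scale l w" by (simp_all add: p_def q_def)
      have wS: "w \<in> S" "p \<in> S" using TS pq by (auto intro: span_base)
      \<comment> \<open>Products with a factor in \<open>?P\<close> stay in \<open>?P\<close>; the
        remaining product ww is a multiple of w because N(w) = 0.\<close>
      have "mult p q \<in> ?P" "mult p w \<in> ?P" "mult w q \<in> ?P"
        using orth_mult[OF S(1) one] wS pq by blast+
      moreover have "mult w w = scale (trace w) w" using w(2) by (simp add: square)
      ultimately show ?thesis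
        unfolding xy by (auto intro!: span_add span_scale intro: span_base)
    qed
    then have "subalgebra ?T" by (simp add: subalgebra_def)
    then show ?thesis using TS dT ts by blast
  next
    case False
    let ?K = "{s \<in> S. mult s n = 0}" and ?T = "range (\<lambda>x. mult x n)"
    \<comment> \<open>Now dim S is at least 6, and the kernel bound is 2 dim S - 8.\<close>
    have "dim ?K \<ge> 4" using kernel[OF n(1)] dim S(2) False by simp
    moreover have "?K \<subseteq> ?T" using range_mult_right_eq_kernel[OF nn n(2)] by blast
    moreover have "subspace ?K" using sub by (auto simp: subspace_def)
    ultimately have "?K = ?T"
      using dim_range_mult_right[OF nn n(2)] totally_singularD(1)[OF totally_singular_range_mult_right[OF nn n(2)]]
      by (intro subspace_dim_equal) auto
    then have "?T \<subseteq> S" by blast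
    then show ?thesis
      using subalgebra_range_mult_right dim_range_mult_right totally_singular_range_mult_right nn n(2)
      by blast
  qed
qed

section \<open>Consequences for non-associative subalgebras\<close>

lemma large_subalgebra:
  assumes "subalgebra S" "dim S > 4" "norm_split N \<or> S \<noteq> UNIV"
  shows "\<exists>T. subalgebra T \<and> T \<subseteq> S \<and> dim T = 4 \<and> \<not> associative_on mult T"
  using totally_singular_subalgebra_exists[OF assms] subalgebra_dim_4_not_associative_iff by blast

lemma not_associative_totally_singular:
  assumes S: "subalgebra S" "norm_split N \<or> S \<noteq> UNIV" and na: "\<not> associative_on mult S"
  shows "\<exists>V. totally_singular V \<and> dim V = 4 \<and> V \<subseteq> S"
proof (cases "dim S > 4")
  case True
  then show ?thesis using totally_singular_subalgebra_exists[OF S(1) _ S(2)] by blast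
next
  case False
  moreover have "\<not> dim S < 4" using subalgebra_dim_less_4_associative S(1) na by blast
  ultimately have "dim S = 4" by simp
  then show ?thesis using subalgebra_dim_4_not_associative_iff[OF S(1)] na by blast
qed

lemma not_associative_iff:
  assumes split: "norm_split N" and S: "subalgebra S"
  shows "\<not> associative_on mult S \<longleftrightarrow> (\<exists>V. maximal_totally_singular V \<and> V \<subseteq> S)"
proof
  assume "\<not> associative_on mult S"
  then show "\<exists>V. maximal_totally_singular V \<and> V \<subseteq> S"
    using not_associative_totally_singular[OF S] split maximal_totally_singular_iff by blast
next
  assume "\<exists>V. maximal_totally_singular V \<and> V \<subseteq> S"
  then obtain V where V: "totally_singular V" "dim V = 4" "V \<subseteq> S"
    using maximal_totally_singular_iff[OF split] by blast
  then consider "dim S = 4" | "dim S > 4" using dim_subset[OF V(3)] by linarith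
  then show "\<not> associative_on mult S"
  proof cases
    case 1
    then have "V = S"
      using V S by (intro subspace_dim_equal) (auto simp: subalgebra_def dest: totally_singularD)
    then show ?thesis using subalgebra_dim_4_not_associative_iff[OF S 1] V(1) by simp
  next
    case 2
    then obtain T where "T \<subseteq> S" "\<not> associative_on mult T"
      using large_subalgebra[OF S] split by blast
    then show ?thesis unfolding associative_on_def by blast
  qed
qed

text \<open>Non-associativity would produce a totally singular subspace of dimension 4, but without
  singular vectors only {0} is totally singular.\<close>

lemma proper_subalgebra_associative:
  assumes ns: "\<not> norm_split N" and S: "subalgebra S" "S \<noteq> UNIV"
  shows "associative_on mult S"
proof (rule ccontr)
  assume "\<not> associative_on mult S"
  then obtain T where T: "totally_singular T" "dim T = 4"
    using not_associative_totally_singular[OF S(1)] S(2) by blast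
  have "T \<subseteq> {0}" using ns totally_singularD(2)[OF T(1)] by (auto simp: norm_split_def)
  then have "dim T = 0" by (simp only: dim_eq_0)
  then show False using T(2) by simp
qed

lemma not_associative_dim_4_exists:
  assumes "norm_split N"
  shows "\<exists>S. subalgebra S \<and> dim S = 4 \<and> \<not> associative_on mult S"
proof -
  obtain n where "mult n n = 0" "n \<noteq> 0" using ex_square_zero[OF assms] by blast
  then show ?thesis
    using subalgebra_range_mult dim_range_mult_kernel(1) range_mult_not_associative by blast
qed

end

theorem mainTheorem4:
  fixes scale :: "'f::field \<Rightarrow> 'a::ab_group_add \<Rightarrow> 'a"
    and mult :: "'a \<Rightarrow> 'a \<Rightarrow> 'a"
    and N :: "'a \<Rightarrow> 'f"
    and one :: 'a
  assumes "octonion_algebra scale mult N one"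
  shows
    "(\<forall>S. nonassoc_algebra.subalgebra scale mult S \<and> vector_space.dim scale S < 4
        \<longrightarrow> associative_on mult S)
   \<and>
     (norm_split N \<longrightarrow>
        (\<exists>S. nonassoc_algebra.subalgebra scale mult S \<and> vector_space.dim scale S = 4
             \<and> \<not> associative_on mult S)
      \<and> (\<forall>S. nonassoc_algebra.subalgebra scale mult S \<and> vector_space.dim scale S = 4 \<longrightarrow>
             (\<not> associative_on mult S \<longleftrightarrow> quadratic_space.totally_singular scale N S))
      \<and> (\<forall>S. nonassoc_algebra.subalgebra scale mult S \<and> vector_space.dim scale S = 4
             \<and> quadratic_space.totally_singular scale N S
           \<longleftrightarrow> (\<exists>n. mult n n = 0 \<and> n \<noteq> 0
                  \<and> (S = range (\<lambda>x. mult n x) \<or> S = range (\<lambda>x. mult x n)))))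
   \<and>
     (\<forall>S. nonassoc_algebra.subalgebra scale mult S \<and> vector_space.dim scale S = 4
          \<and> \<not> quadratic_space.totally_singular scale N S
        \<longrightarrow> associative_on mult S)
   \<and>
     (\<forall>S. nonassoc_algebra.subalgebra scale mult S \<and> vector_space.dim scale S > 4
          \<and> (norm_split N \<or> S \<noteq> UNIV)
        \<longrightarrow> (\<exists>T. nonassoc_algebra.subalgebra scale mult T \<and> T \<subseteq> S
                 \<and> vector_space.dim scale T = 4 \<and> \<not> associative_on mult T))
   \<and>
     (norm_split N \<longrightarrow>
        (\<forall>S. nonassoc_algebra.subalgebra scale mult S \<longrightarrow>
           (\<not> associative_on mult S \<longleftrightarrow>
              (\<exists>V. quadratic_space.maximal_totally_singular scale N V \<and> V \<subseteq> S))))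
   \<and>
     (\<not> norm_split N \<longrightarrow>
        (\<forall>S. nonassoc_algebra.subalgebra scale mult S \<and> S \<noteq> UNIV
           \<longrightarrow> associative_on mult S))"
proof -
  interpret octonion_algebra scale mult N one by fact
  show ?thesis
    apply (intro conjI impI allI)
    subgoal for S using subalgebra_dim_less_4_associative[of S] by blast
    subgoal by (rule not_associative_dim_4_exists)
    subgoal for S using subalgebra_dim_4_not_associative_iff[of S] by blast
    subgoal by (rule totally_singular_subalgebra_iff)
    subgoal for S using subalgebra_dim_4_not_associative_iff[of S] by blast
    subgoal for S using large_subalgebra[of S] by blast
    subgoal by (rule not_associative_iff)
    subgoal for S using proper_subalgebra_associative[of S] by blast
    done
qed

end
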